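(* Let $\mathbb{F}$ be a field and let $d\ge 2$ be an integer. Let $X_1,\dots,X_d$ be finite sets and for each $i$ let $X_i=X_i^1\cup X_i^2$ be a disjoint union. Let $T_1:X_1^1\times\dots\times X_d^1\to\mathbb{F}$ and $T_2:X_1^2\times\dots\times X_d^2\to\mathbb{F}$ be any two tensors. Then $$\sigma(T_1\oplus T_2)=\sigma(T_1)+\sigma(T_2).$$
   Context: A $d$-tensor over a field $\mathbb{F}$ is a function $T:X_1\times\dots\times X_d\to\mathbb{F}$, where $X_1,\dots,X_d$ are finite sets. A $d$-tensor $T$ has slice rank 1 if there is $i\in\{1,\dots,d\}$ such that $T$ is a product $T(x_1,\dots,x_d)=u(x_i)\,v(x_1,\dots,x_{i-1},x_{i+1},\dots,x_d)$ of a function $u$ depending only on $x_i$ and a function $v$ depending only on the remaining variables. The slice rank $\sigma(T)$ of $T$ is the smallest $r\ge 0$ such that $T$ is a sum of $r$ tensors of this form (different terms may use different $i$; the zero tensor has slice rank 0). With $X_i=X_i^1\cup X_i^2$ (disjoint) for each $i$, the direct sum $T_1\oplus T_2:X_1\times\dots\times X_d\to\mathbb{F}$ is the tensor that takes the value $T_1(x_1,\dots,x_d)$ if $x_i\in X_i^1$ for every $i$, the value $T_2(x_1,\dots,x_d)$ if $x_i\in X_i^2$ for every $i$, and $0$ otherwise. *)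

theory Defs
  imports Complex_Main "HOL-Library.FuncSet"
begin

text \<open>
  A \<open>d\<close>-tuple is a function on the index set \<open>{1..d}\<close>, and \<open>X\<^sub>1 \<times> \<dots> \<times> X\<^sub>d\<close> is \<open>PiE {1..d} X\<close>.
  A \<open>d\<close>-tensor on \<open>X\<^sub>1 \<times> \<dots> \<times> X\<^sub>d\<close> is represented by a total function on tuples; only its values on
  \<open>PiE {1..d} X\<close> matter, so equality of tensors is equality on that set.
\<close>

type_synonym ('a, 'f) tensor = "(nat \<Rightarrow> 'a) \<Rightarrow> 'f"

text \<open>
  The restriction of \<open>x\<close> to \<open>{1..d} - {i}\<close> is the tuple \<open>x\<close> with its \<open>i\<close>-th entry deleted.
  As \<open>u\<close> or \<open>v\<close> may vanish, the zero tensor is included here, which does not affect \<open>slice_rank\<close>.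
\<close>

definition slice_rank_one :: "nat \<Rightarrow> (nat \<Rightarrow> 'a set) \<Rightarrow> ('a, 'f::field) tensor \<Rightarrow> bool" where
  "slice_rank_one d X T \<longleftrightarrow>
     (\<exists>i\<in>{1..d}. \<exists>(u :: 'a \<Rightarrow> 'f) (v :: (nat \<Rightarrow> 'a) \<Rightarrow> 'f).
        \<forall>x\<in>PiE {1..d} X. T x = u (x i) * v (restrict x ({1..d} - {i})))"

definition slice_rank :: "nat \<Rightarrow> (nat \<Rightarrow> 'a set) \<Rightarrow> ('a, 'f::field) tensor \<Rightarrow> nat" where
  "slice_rank d X T =
     (LEAST r. \<exists>S :: nat \<Rightarrow> ('a, 'f) tensor.
        (\<forall>j<r. slice_rank_one d X (S j)) \<and>
        (\<forall>x\<in>PiE {1..d} X. T x = (\<Sum>j<r. S j x)))"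

definition tensor_direct_sum ::
  "nat \<Rightarrow> (nat \<Rightarrow> 'a set) \<Rightarrow> (nat \<Rightarrow> 'a set) \<Rightarrow>
     ('a, 'f::field) tensor \<Rightarrow> ('a, 'f) tensor \<Rightarrow> ('a, 'f) tensor" where
  "tensor_direct_sum d X1 X2 T1 T2 x =
     (if \<forall>i\<in>{1..d}. x i \<in> X1 i then T1 x
      else if \<forall>i\<in>{1..d}. x i \<in> X2 i then T2 x
      else 0)"

lemma slice_rank_cong:
  assumes "\<And>x. x \<in> PiE {1..d} X \<Longrightarrow> T x = T' x"
  shows "slice_rank d X T = slice_rank d X T'"
  using assms by (simp add: slice_rank_def cong: ball_cong)

text \<open>The set of lengths minimised in \<open>slice_rank\<close> is nonempty.\<close>

lemma slice_decomposition_exists: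
  fixes T :: "('a, 'f::field) tensor"
  assumes "d \<ge> 1" and "\<And>i. i \<in> {1..d} \<Longrightarrow> finite (X i)"
  shows "\<exists>r. \<exists>S :: nat \<Rightarrow> ('a, 'f) tensor.
           (\<forall>j<r. slice_rank_one d X (S j)) \<and>
           (\<forall>x\<in>PiE {1..d} X. T x = (\<Sum>j<r. S j x))"
proof -
  have one: "1 \<in> {1..d}" using assms(1) by simp
  obtain h where h: "bij_betw h {..<card (X 1)} (X 1)"
    using ex_bij_betw_nat_finite[OF assms(2)[OF one]] by (auto simp: atLeast0LessThan)
  define S :: "nat \<Rightarrow> ('a, 'f) tensor" where
    "S j x = (if x 1 = h j then 1 else 0) * T ((restrict x ({1..d} - {1}))(1 := h j))" for j x
  have "slice_rank_one d X (S j)" for j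
    unfolding slice_rank_one_def
  proof (intro bexI[OF _ one] exI ballI)
    fix x show "S j x = (\<lambda>a. if a = h j then 1 else 0) (x 1) *
        (\<lambda>y. T (y(1 := h j))) (restrict x ({1..d} - {1}))" by (simp add: S_def)
  qed
  moreover have "T x = (\<Sum>j<card (X 1). S j x)" if x: "x \<in> PiE {1..d} X" for x
  proof -
    have x1: "x 1 \<in> X 1" using x one by (rule PiE_mem)
    have restr: "(restrict x ({1..d} - {1}))(1 := x 1) = x"
    proof
      fix k show "((restrict x ({1..d} - {1}))(1 := x 1)) k = x k"
        by (cases "k \<in> {1..d}") (simp_all add: PiE_arb[OF x])
    qed
    have "(\<Sum>j<card (X 1). S j x) =
        (\<Sum>a\<in>X 1. (if x 1 = a then 1 else 0) * T ((restrict x ({1..d} - {1}))(1 := a)))"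
      unfolding S_def by (rule sum.reindex_bij_betw[OF h])
    also have "\<dots> = (\<Sum>a\<in>X 1. if x 1 = a then T x else 0)"
    proof (rule sum.cong[OF refl])
      fix a
      show "(if x 1 = a then 1 else 0) * T ((restrict x ({1..d} - {1}))(1 := a)) =
          (if x 1 = a then T x else 0)"
      proof (cases "x 1 = a")
        case True
        then have "(restrict x ({1..d} - {1}))(1 := a) = x" using restr by (simp only:)
        with True show ?thesis by (simp only: if_True mult_1_left refl simp_thms)
      qed simp
    qed
    also have "\<dots> = T x" using x1 assms(2)[OF one] by simp
    finally show ?thesis by simp
  qed
  ultimately show ?thesis by blast
qed

end

theory Submission
  imports Defs
begin

text \<open>
  Fix a decomposition of \<open>T\<^sub>1 \<oplus> T\<^sub>2\<close> into slices and let \<open>W\<^sub>i\<close> be the span of its one-variable factors in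
  direction \<open>i\<close>. For \<open>Y \<subseteq> X\<^sub>i\<close>, the dimension of \<open>W\<^sub>i\<close> is the dimension of the restriction \<open>W\<^sub>i|Y\<close> plus
  that of the kernel \<open>{w \<in> W\<^sub>i. w|Y = 0}\<close>; take \<open>Y = X\<^sub>1\<^sup>1\<close> if \<open>i = 1\<close> and \<open>Y = X\<^sub>i\<^sup>2\<close> otherwise. When
  \<open>x\<^sub>1 \<in> X\<^sub>1\<^sup>1\<close>, the direct sum vanishes as soon as \<open>x\<^sub>i \<in> X\<^sub>i\<^sup>2\<close> for some \<open>i \<ge> 2\<close>, and this allows
  \<open>W\<^sub>i\<close> to be replaced by the kernel for all \<open>i \<ge> 2\<close>, so that \<open>T\<^sub>1\<close> needs the restriction in direction
  1 and the kernels in the others. Exchanging roles, \<open>T\<^sub>2\<close> needs the kernel in direction 1 and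
  the restrictions in the others, so the two counts add up to at most the original one.
\<close>

section \<open>Slice rank through explicit decompositions\<close>

text \<open>The index set is arbitrary because later decompositions are indexed by pairs (direction,
  term) and by a disjoint sum.\<close>

lemma slice_rank_le_card:
  fixes T :: "('a, 'f::field) tensor"
  assumes fin: "finite J"
    and one: "\<And>j. j \<in> J \<Longrightarrow> slice_rank_one d X (S j)"
    and T: "\<And>x. x \<in> PiE {1..d} X \<Longrightarrow> T x = (\<Sum>j\<in>J. S j x)"
  shows "slice_rank d X T \<le> card J"
proof -
  obtain h where h: "bij_betw h {..<card J} J"
    using ex_bij_betw_nat_finite[OF fin] by (auto simp: atLeast0LessThan)
  have "\<forall>j<card J. slice_rank_one d X ((S \<circ> h) j)"
    using one bij_betwE[OF h] by simp
  moreover have "\<forall>x\<in>PiE {1..d} X. T x = (\<Sum>j<card J. (S \<circ> h) j x)"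
    using T sum.reindex_bij_betw[OF h, of "\<lambda>j. S j _"] by simp
  ultimately show ?thesis
    unfolding slice_rank_def by (intro Least_le) blast
qed

lemma slice_rank_decomposition:
  fixes T :: "('a, 'f::field) tensor"
  assumes "d \<ge> 1" and "\<And>i. i \<in> {1..d} \<Longrightarrow> finite (X i)"
  obtains S :: "nat \<Rightarrow> ('a, 'f) tensor"
    where "\<And>j. j < slice_rank d X T \<Longrightarrow> slice_rank_one d X (S j)"
      and "\<And>x. x \<in> PiE {1..d} X \<Longrightarrow> T x = (\<Sum>j<slice_rank d X T. S j x)"
proof -
  have "\<exists>S. (\<forall>j<slice_rank d X T. slice_rank_one d X (S j)) \<and>
      (\<forall>x\<in>PiE {1..d} X. T x = (\<Sum>j<slice_rank d X T. S j x))"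
    unfolding slice_rank_def by (rule LeastI_ex, rule slice_decomposition_exists[OF assms])
  then show thesis using that by blast
qed

section \<open>Decompositions with prescribed one-variable factors\<close>

text \<open>For finite \<open>J i\<close> this is membership of \<open>T\<close>, on the box
  \<open>Z\<close>, in the sum over \<open>i\<close> of the span of the \<open>u i j\<close>
  tensored with all functions of the remaining variables. The cofactors \<open>v\<close> stay
  existential since the argument only controls the spans of the one-variable factors.\<close>

definition sliced_by ::
  "nat \<Rightarrow> (nat \<Rightarrow> 'a set) \<Rightarrow> (nat \<Rightarrow> 'j set) \<Rightarrow> (nat \<Rightarrow> 'j \<Rightarrow> 'a \<Rightarrow> 'f) \<Rightarrow>
     ('a, 'f::field) tensor \<Rightarrow> bool" where
  "sliced_by d Z J u T \<longleftrightarrow>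
     (\<exists>v. \<forall>x\<in>PiE {1..d} Z.
        T x = (\<Sum>i\<in>{1..d}. \<Sum>j\<in>J i. u i j (x i) * v i j (restrict x ({1..d} - {i}))))"

lemma sliced_by_mono:
  assumes "sliced_by d Z J u T" and "\<And>i. i \<in> {1..d} \<Longrightarrow> Z' i \<subseteq> Z i"
    and "\<And>x. x \<in> PiE {1..d} Z' \<Longrightarrow> T' x = T x"
  shows "sliced_by d Z' J u T'"
proof -
  have sub: "PiE {1..d} Z' \<subseteq> PiE {1..d} Z" using assms(2) by (rule PiE_mono)
  obtain v where "\<forall>x\<in>PiE {1..d} Z. T x =
      (\<Sum>i\<in>{1..d}. \<Sum>j\<in>J i. u i j (x i) * v i j (restrict x ({1..d} - {i})))"
    using assms(1) unfolding sliced_by_def ..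
  then show ?thesis
    unfolding sliced_by_def using sub assms(3) by (intro exI[of _ v] ballI) (simp add: subsetD)
qed

lemma slice_rank_le_sliced_by:
  fixes T :: "('a, 'f::field) tensor"
  assumes "sliced_by d Z J u T" and fin: "\<And>i. i \<in> {1..d} \<Longrightarrow> finite (J i)"
  shows "slice_rank d Z T \<le> (\<Sum>i\<in>{1..d}. card (J i))"
proof -
  obtain v where v: "\<And>x. x \<in> PiE {1..d} Z \<Longrightarrow>
      T x = (\<Sum>i\<in>{1..d}. \<Sum>j\<in>J i. u i j (x i) * v i j (restrict x ({1..d} - {i})))"
    using assms(1) unfolding sliced_by_def by blast
  define S where "S = (\<lambda>(i, j) x. u i j (x i) * v i j (restrict x ({1..d} - {i})))"
  have "slice_rank d Z T \<le> card (Sigma {1..d} J)"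
  proof (rule slice_rank_le_card)
    show "finite (Sigma {1..d} J)" using fin by auto
    show "slice_rank_one d Z (S a)" if "a \<in> Sigma {1..d} J" for a
      using that unfolding slice_rank_one_def S_def split_def by (intro bexI[of _ "fst a"]) (blast, auto)
    show "T x = (\<Sum>a\<in>Sigma {1..d} J. S a x)" if "x \<in> PiE {1..d} Z" for x
      using v[OF that] fin by (simp add: sum.Sigma S_def split_def)
  qed
  then show ?thesis using fin by simp
qed

text \<open>The terms of a minimal decomposition are sorted by direction; each lies in exactly one
  \<open>J i\<close>, so their number is preserved.\<close>

lemma sliced_by_slice_rank:
  fixes T :: "('a, 'f::field) tensor"
  assumes "d \<ge> 1" and "\<And>i. i \<in> {1..d} \<Longrightarrow> finite (X i)"
  obtains J :: "nat \<Rightarrow> nat set" and u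
    where "sliced_by d X J u T" and "\<And>i. finite (J i)"
      and "(\<Sum>i\<in>{1..d}. card (J i)) = slice_rank d X T"
proof -
  let ?r = "slice_rank d X T"
  obtain S :: "nat \<Rightarrow> ('a, 'f) tensor"
    where S: "\<And>j. j < ?r \<Longrightarrow> slice_rank_one d X (S j)"
      and T: "\<And>x. x \<in> PiE {1..d} X \<Longrightarrow> T x = (\<Sum>j<?r. S j x)"
    by (rule slice_rank_decomposition[of d X T]) (use assms in auto)
  have "\<forall>j. \<exists>i u v. j < ?r \<longrightarrow> i \<in> {1..d} \<and>
      (\<forall>x\<in>PiE {1..d} X. S j x = u (x i) * v (restrict x ({1..d} - {i})))"
    using S unfolding slice_rank_one_def by metis
  then obtain dir u v where dir: "\<And>j. j < ?r \<Longrightarrow> dir j \<in> {1..d}"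
    and uv: "\<And>j x. j < ?r \<Longrightarrow> x \<in> PiE {1..d} X \<Longrightarrow>
      S j x = u j (x (dir j)) * v j (restrict x ({1..d} - {dir j}))"
    by metis
  define J where "J i = {j \<in> {..<?r}. dir j = i}" for i
  have regroup: "(\<Sum>i\<in>{1..d}. \<Sum>j\<in>J i. f j) = (\<Sum>j<?r. f j)" for f :: "nat \<Rightarrow> 'c::comm_monoid_add"
    unfolding J_def by (rule sum.group) (use dir in auto)
  show thesis
  proof
    show "sliced_by d X J (\<lambda>i j. u j) T"
      unfolding sliced_by_def
    proof (intro exI ballI)
      fix x assume x: "x \<in> PiE {1..d} X"
      have "T x = (\<Sum>i\<in>{1..d}. \<Sum>j\<in>J i. S j x)"
        using T[OF x] regroup[of "\<lambda>j. S j x"] by simp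
      also have "\<dots> = (\<Sum>i\<in>{1..d}. \<Sum>j\<in>J i. u j (x i) * v j (restrict x ({1..d} - {i})))"
        by (intro sum.cong refl) (auto simp: J_def uv[OF _ x])
      finally show "T x = (\<Sum>i\<in>{1..d}. \<Sum>j\<in>J i. u j (x i) * (\<lambda>i. v) i j (restrict x ({1..d} - {i})))" .
    qed
    show "finite (J i)" for i by (simp add: J_def)
    show "(\<Sum>i\<in>{1..d}. card (J i)) = ?r"
      using regroup[of "\<lambda>_. 1 :: nat"] by simp
  qed
qed

text \<open>Expanding each old factor in the new ones and exchanging the two sums moves the
  coefficients \<open>b\<close> into the cofactors, which are arbitrary. The expansions are compared
  on \<open>Z i\<close> alone, which is how restricting a factor enters.\<close>

lemma sliced_by_change_span:
  fixes T :: "('a, 'f::field) tensor"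
  assumes "sliced_by d Z J u T"
    and span: "\<And>i j. i \<in> {1..d} \<Longrightarrow> j \<in> J i \<Longrightarrow>
      \<exists>b. \<forall>a\<in>Z i. u i j a = (\<Sum>k\<in>J' i. b k * u' i k a)"
  shows "sliced_by d Z J' u' T"
proof -
  obtain v where v: "\<And>x. x \<in> PiE {1..d} Z \<Longrightarrow>
      T x = (\<Sum>i\<in>{1..d}. \<Sum>j\<in>J i. u i j (x i) * v i j (restrict x ({1..d} - {i})))"
    using assms(1) unfolding sliced_by_def by blast
  obtain b where b: "\<And>i j a. i \<in> {1..d} \<Longrightarrow> j \<in> J i \<Longrightarrow> a \<in> Z i \<Longrightarrow>
      u i j a = (\<Sum>k\<in>J' i. b i j k * u' i k a)"
    using span by metis
  show ?thesis
    unfolding sliced_by_def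
  proof (intro exI ballI)
    fix x assume x: "x \<in> PiE {1..d} Z"
    show "T x = (\<Sum>i\<in>{1..d}. \<Sum>k\<in>J' i. u' i k (x i) *
        (\<lambda>i k z. \<Sum>j\<in>J i. b i j k * v i j z) i k (restrict x ({1..d} - {i})))"
      unfolding v[OF x]
    proof (intro sum.cong refl)
      fix i assume i: "i \<in> {1..d}"
      let ?z = "restrict x ({1..d} - {i})"
      have "x i \<in> Z i" using x i by (rule PiE_mem)
      then have "(\<Sum>j\<in>J i. u i j (x i) * v i j ?z) =
          (\<Sum>j\<in>J i. \<Sum>k\<in>J' i. b i j k * u' i k (x i) * v i j ?z)"
        using i by (simp add: b sum_distrib_right)
      also have "\<dots> = (\<Sum>k\<in>J' i. u' i k (x i) * (\<Sum>j\<in>J i. b i j k * v i j ?z))"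
        by (subst sum.swap) (simp add: sum_distrib_left mult_ac)
      finally show "(\<Sum>j\<in>J i. u i j (x i) * v i j ?z) =
          (\<Sum>k\<in>J' i. u' i k (x i) * (\<Sum>j\<in>J i. b i j k * v i j ?z))" .
    qed
  qed
qed

section \<open>Splitting a span into kernel and restriction\<close>

text \<open>
  Rank-nullity for the restriction to \<open>Y\<close>: modulo the functions \<open>g\<^sub>l\<close>, whose coefficients are functionals
  supported on \<open>Y\<close>, every \<open>u\<^sub>j\<close> is a combination of functions vanishing on \<open>Y\<close>.
\<close>

lemma restriction_kernel_split:
  fixes u :: "'j \<Rightarrow> 'a \<Rightarrow> 'f::field"
  assumes "finite J" and "finite Y"
  shows "\<exists>K w g \<phi> c. K \<subseteq> J \<and> (\<forall>k\<in>J - K. \<forall>y\<in>Y. w k y = 0) \<and>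
    (\<forall>j\<in>J. \<forall>a. u j a = (\<Sum>k\<in>J - K. c j k * w k a) +
      (\<Sum>l\<in>K. (\<Sum>y\<in>Y. \<phi> l y * u j y) * g l a))"
  using assms(1)
proof (induction J rule: finite_induct)
  case empty
  then show ?case by auto
next
  case (insert n J)
  then obtain K w g \<phi> c where K: "K \<subseteq> J" and w: "\<And>k y. k \<in> J - K \<Longrightarrow> y \<in> Y \<Longrightarrow> w k y = 0"
    and u: "\<And>j a. j \<in> J \<Longrightarrow> u j a = (\<Sum>k\<in>J - K. c j k * w k a) +
      (\<Sum>l\<in>K. (\<Sum>y\<in>Y. \<phi> l y * u j y) * g l a)"
    by blast
  have finK: "finite K" using K insert.hyps(1) by (rule finite_subset)
  have nK: "n \<notin> K" using K insert.hyps(2) by blast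
  \<comment> \<open>The residual of the new factor modulo the \<open>g l\<close> found so far:
    either it vanishes on \<open>Y\<close> and joins the kernel functions, or it becomes a new
    \<open>g\<close>.\<close>
  define r where "r a = u n a - (\<Sum>l\<in>K. (\<Sum>y\<in>Y. \<phi> l y * u n y) * g l a)" for a
  show ?case
  proof (cases "\<forall>y\<in>Y. r y = 0")
    case True
    define w' where "w' = w(n := r)"
    define c' where "c' j k = (if j = n then (if k = n then 1 else 0)
      else (if k = n then 0 else c j k))" for j k
    have J': "insert n J - K = insert n (J - K)" using nK by auto
    have u': "u j a = (\<Sum>k\<in>insert n J - K. c' j k * w' k a) +
        (\<Sum>l\<in>K. (\<Sum>y\<in>Y. \<phi> l y * u j y) * g l a)" if j: "j \<in> insert n J" for j a
    proof (cases "j = n")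
      case True
      have "(\<Sum>k\<in>J - K. c' n k * w' k a) = 0"
        using insert.hyps(2) by (intro sum.neutral) (auto simp: c'_def)
      then show ?thesis
        using True insert.hyps by (simp add: J' c'_def[of n n] w'_def r_def)
    next
      case False
      have "(\<Sum>k\<in>J - K. c' j k * w' k a) = (\<Sum>k\<in>J - K. c j k * w k a)"
        using insert.hyps(2) False by (intro sum.cong) (auto simp: c'_def w'_def)
      then show ?thesis
        using False j insert.hyps u[of j a] by (simp add: J' c'_def[of j n])
    qed
    have w': "w' k y = 0" if "k \<in> insert n J - K" "y \<in> Y" for k y
      using that True w by (auto simp: w'_def)
    then show ?thesis
      using K by (intro exI[of _ K] exI[of _ w'] exI[of _ g] exI[of _ \<phi>] exI[of _ c']
          conjI ballI allI w' u') auto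
  next
    case False
    then obtain y0 where y0: "y0 \<in> Y" "r y0 \<noteq> 0" by blast
    define g' where "g' = g(n := r)"
    \<comment> \<open>Evaluation at \<open>y0\<close> of the residual of a function, scaled to give
      1 on \<open>u n\<close>. It gives 0 on every earlier \<open>u j\<close>, whose residual is a
      combination of the \<open>w k\<close>, and these vanish at \<open>y0\<close>; so the earlier
      identities keep their form.\<close>
    define \<psi> where "\<psi> y = ((if y = y0 then 1 else 0) - (\<Sum>l\<in>K. g l y0 * \<phi> l y)) / r y0" for y
    define \<phi>' where "\<phi>' = \<phi>(n := \<psi>)"
    define c' where "c' j k = (if j = n then 0 else c j k)" for j k
    have \<psi>: "(\<Sum>y\<in>Y. \<psi> y * f y) =
        (f y0 - (\<Sum>l\<in>K. (\<Sum>y\<in>Y. \<phi> l y * f y) * g l y0)) / r y0" for f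
    proof -
      have "(\<Sum>y\<in>Y. \<psi> y * f y) =
          (\<Sum>y\<in>Y. (if y = y0 then f y else 0) - (\<Sum>l\<in>K. g l y0 * \<phi> l y * f y)) / r y0"
        unfolding sum_divide_distrib
        by (intro sum.cong) (auto simp: \<psi>_def left_diff_distrib sum_distrib_right)
      also have "(\<Sum>y\<in>Y. (if y = y0 then f y else 0) - (\<Sum>l\<in>K. g l y0 * \<phi> l y * f y)) =
          f y0 - (\<Sum>y\<in>Y. \<Sum>l\<in>K. g l y0 * \<phi> l y * f y)"
        using y0(1) assms(2) by (simp add: sum_subtractf)
      also have "(\<Sum>y\<in>Y. \<Sum>l\<in>K. g l y0 * \<phi> l y * f y) =
          (\<Sum>l\<in>K. (\<Sum>y\<in>Y. \<phi> l y * f y) * g l y0)"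
        by (subst sum.swap) (simp add: sum_distrib_left mult_ac)
      finally show ?thesis .
    qed
    have \<psi>n: "(\<Sum>y\<in>Y. \<psi> y * u n y) = 1"
      using y0(2) by (simp add: \<psi> r_def)
    have \<psi>j: "(\<Sum>y\<in>Y. \<psi> y * u j y) = 0" if "j \<in> J" for j
    proof -
      have "(\<Sum>k\<in>J - K. c j k * w k y0) = 0"
        using w y0(1) by (intro sum.neutral) auto
      then show ?thesis using u[OF that, of y0] by (simp add: \<psi>)
    qed
    have J': "insert n J - insert n K = J - K" using insert.hyps(2) by auto
    have old: "(\<Sum>l\<in>K. (\<Sum>y\<in>Y. \<phi>' l y * u j y) * g' l a) =
        (\<Sum>l\<in>K. (\<Sum>y\<in>Y. \<phi> l y * u j y) * g l a)" for j a
      using nK by (intro sum.cong) (auto simp: \<phi>'_def g'_def)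
    have u': "u j a = (\<Sum>k\<in>insert n J - insert n K. c' j k * w k a) +
        (\<Sum>l\<in>insert n K. (\<Sum>y\<in>Y. \<phi>' l y * u j y) * g' l a)" if j: "j \<in> insert n J" for j a
    proof (cases "j = n")
      case True
      then show ?thesis
        using finK nK by (simp add: J' old c'_def) (simp add: \<phi>'_def g'_def \<psi>n r_def)
    next
      case False
      then show ?thesis
        using j finK nK u[of j a] by (simp add: J' old c'_def) (simp add: \<phi>'_def \<psi>j)
    qed
    show ?thesis
      using K by (intro exI[of _ "insert n K"] exI[of _ w] exI[of _ g'] exI[of _ \<phi>'] exI[of _ c']
          conjI ballI allI w u') auto
  qed
qed

text \<open>
  Applies \<open>f \<mapsto> f - (\<Sum>l. \<langle>\<phi>\<^sub>l, f\<rangle> g\<^sub>l)\<close> in the variable \<open>x\<^sub>i\<close>: this fixes \<open>T\<close>, preserves slices in the other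
  directions, and maps every factor \<open>u\<^sub>j\<close> into the span of the \<open>w\<^sub>k\<close>.
\<close>

lemma sliced_by_kernel:
  fixes T :: "('a, 'f::field) tensor"
  assumes T: "sliced_by d Z J u T" and i: "i \<in> {1..d}"
    and Y: "Y \<subseteq> Z i"
    and vanish: "\<And>x. x \<in> PiE {1..d} Z \<Longrightarrow> x i \<in> Y \<Longrightarrow> T x = 0"
    and split: "\<And>j a. j \<in> J i \<Longrightarrow> u i j a = (\<Sum>k\<in>M. c j k * w k a) +
      (\<Sum>l\<in>K. (\<Sum>y\<in>Y. \<phi> l y * u i j y) * g l a)"
  shows "sliced_by d Z (J(i := M)) (u(i := w)) T"
proof -
  obtain v where v: "\<And>x. x \<in> PiE {1..d} Z \<Longrightarrow>
      T x = (\<Sum>i\<in>{1..d}. \<Sum>j\<in>J i. u i j (x i) * v i j (restrict x ({1..d} - {i})))"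
    using T unfolding sliced_by_def by blast
  define P :: "('a, 'f) tensor \<Rightarrow> ('a, 'f) tensor" where
    "P f x = f x - (\<Sum>l\<in>K. g l (x i) * (\<Sum>y\<in>Y. \<phi> l y * f (x(i := y))))" for f x
  have P_sum: "P (\<lambda>x. \<Sum>a\<in>A. F a x) x = (\<Sum>a\<in>A. P (F a) x)" for A :: "'n set" and F x
  proof -
    have "(\<Sum>l\<in>K. g l (x i) * (\<Sum>y\<in>Y. \<phi> l y * (\<Sum>a\<in>A. F a (x(i := y))))) =
        (\<Sum>l\<in>K. \<Sum>y\<in>Y. \<Sum>a\<in>A. g l (x i) * (\<phi> l y * F a (x(i := y))))"
      by (simp add: sum_distrib_left)
    also have "\<dots> = (\<Sum>l\<in>K. \<Sum>a\<in>A. \<Sum>y\<in>Y. g l (x i) * (\<phi> l y * F a (x(i := y))))"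
      by (intro sum.cong refl sum.swap)
    also have "\<dots> = (\<Sum>a\<in>A. \<Sum>l\<in>K. \<Sum>y\<in>Y. g l (x i) * (\<phi> l y * F a (x(i := y))))"
      by (rule sum.swap)
    finally show ?thesis
      by (simp add: P_def sum_subtractf sum_distrib_left)
  qed
  define slice where "slice i' j x = u i' j (x i') * v i' j (restrict x ({1..d} - {i'}))"
    for i' j x
  \<comment> \<open>In direction \<open>i\<close> the new cofactors collect the coefficients
    \<open>c\<close>. In any other direction \<open>i'\<close> the factor is constant in
    \<open>x i\<close>, so \<open>P\<close> passes to the cofactor.\<close>
  define v' where "v' i' j = (if i' = i then (\<lambda>z. \<Sum>k\<in>J i. c k j * v i k z) else P (v i' j))" for i' j
  have "sliced_by d Z (J(i := M)) (\<lambda>i'. if i' = i then w else u i') T"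
    unfolding sliced_by_def
  proof (intro exI[of _ v'] ballI)
    fix x assume x: "x \<in> PiE {1..d} Z"
    have upd: "x(i := y) \<in> PiE {1..d} Z" if "y \<in> Y" for y
      using i Y that PiE_mem[OF x] by (intro PiE_I) (auto simp: PiE_arb[OF x])
    \<comment> \<open>Every correction term evaluates \<open>T\<close> at a point of the box whose
      entry at \<open>i\<close> lies in \<open>Y\<close>, where \<open>T\<close> vanishes.\<close>
    have "T x = P T x"
      using upd vanish by (simp add: P_def)
    also have "\<dots> = P (\<lambda>x. \<Sum>i'\<in>{1..d}. \<Sum>j\<in>J i'. slice i' j x) x"
      using x upd v unfolding P_def slice_def by simp
    also have "\<dots> = (\<Sum>i'\<in>{1..d}. \<Sum>j\<in>J i'. P (slice i' j) x)"
      by (simp add: P_sum)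
    also have "\<dots> = (\<Sum>i'\<in>{1..d}. \<Sum>j\<in>(J(i := M)) i'. (if i' = i then w else u i') j (x i') *
        v' i' j (restrict x ({1..d} - {i'})))"
    proof (rule sum.cong[OF refl])
      fix i' assume "i' \<in> {1..d}"
      let ?z = "restrict x ({1..d} - {i'})"
      show "(\<Sum>j\<in>J i'. P (slice i' j) x) = (\<Sum>j\<in>(J(i := M)) i'. (if i' = i then w else u i') j (x i') *
        v' i' j ?z)"
      proof (cases "i' = i")
        case True
        have r: "restrict (x(i := y)) ({1..d} - {i}) = restrict x ({1..d} - {i})" for y
          by (auto simp: restrict_def)
        \<comment> \<open>The cofactor does not see \<open>x i\<close>, so \<open>P\<close> acts on
          the factor alone and \<open>split\<close> identifies the result.\<close>
        have "P (slice i j) x = (\<Sum>k\<in>M. c j k * w k (x i)) * v i j ?z" if "j \<in> J i" for j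
        proof -
          have "(\<Sum>k\<in>M. c j k * w k (x i)) =
              u i j (x i) - (\<Sum>l\<in>K. (\<Sum>y\<in>Y. \<phi> l y * u i j y) * g l (x i))"
            using split[OF that, of "x i"] by simp
          then show ?thesis
            by (simp add: P_def slice_def r True left_diff_distrib right_diff_distrib sum_distrib_left
                sum_distrib_right mult_ac)
        qed
        then have "(\<Sum>j\<in>J i. P (slice i j) x) =
            (\<Sum>j\<in>J i. \<Sum>k\<in>M. c j k * w k (x i) * v i j ?z)"
          by (simp add: sum_distrib_right)
        also have "\<dots> = (\<Sum>k\<in>M. w k (x i) * (\<Sum>j\<in>J i. c j k * v i j ?z))"
          by (subst sum.swap) (simp add: sum_distrib_left mult_ac)
        finally show ?thesis using True by (simp add: v'_def)
      next
        case False
        have r: "restrict (x(i := y)) ({1..d} - {i'}) = ?z(i := y)" for y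
          using False i by (auto simp: restrict_def)
        have "P (slice i' j) x = u i' j (x i') * P (v i' j) ?z" for j
          using False i
          by (simp add: P_def slice_def r right_diff_distrib sum_distrib_left mult_ac del: One_nat_def)
        then show ?thesis using False by (simp add: v'_def)
      qed
    qed
    finally show "T x = (\<Sum>i'\<in>{1..d}. \<Sum>j\<in>(J(i := M)) i'. (if i' = i then w else u i') j (x i') *
        v' i' j (restrict x ({1..d} - {i'})))" .
  qed
  moreover have "(\<lambda>i'. if i' = i then w else u i') = u(i := w)" by auto
  ultimately show ?thesis by simp
qed

text \<open>The directions in \<open>A\<close> are treated one at a time: a replacement in one
  direction changes neither \<open>T\<close> nor the factors in the others, so the hypotheses for
  the remaining directions survive.\<close>

lemma sliced_by_kernels:
  fixes T :: "('a, 'f::field) tensor"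
  assumes "sliced_by d Z J u T" and "A \<subseteq> {1..d}"
    and "\<And>i. i \<in> A \<Longrightarrow> Y i \<subseteq> Z i"
    and "\<And>i x. i \<in> A \<Longrightarrow> x \<in> PiE {1..d} Z \<Longrightarrow> x i \<in> Y i \<Longrightarrow> T x = 0"
    and "\<And>i j a. i \<in> A \<Longrightarrow> j \<in> J i \<Longrightarrow> u i j a = (\<Sum>k\<in>M i. c i j k * w i k a) +
      (\<Sum>l\<in>K i. (\<Sum>y\<in>Y i. \<phi> i l y * u i j y) * g i l a)"
  shows "sliced_by d Z (\<lambda>i. if i \<in> A then M i else J i) (\<lambda>i. if i \<in> A then w i else u i) T"
proof -
  have "finite A" using assms(2) by (rule finite_subset) simp
  then show ?thesis using assms(2-5)
  proof (induction A rule: finite_induct)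
    case empty
    then show ?case using assms(1) by simp
  next
    case (insert i A)
    let ?J = "\<lambda>i. if i \<in> A then M i else J i" and ?u = "\<lambda>i. if i \<in> A then w i else u i"
    have *: "sliced_by d Z ?J ?u T"
    proof (rule insert.IH)
      show "A \<subseteq> {1..d}" using insert.prems(1) by simp
      show "Y k \<subseteq> Z k" if "k \<in> A" for k
        using that by (intro insert.prems(2)) simp
      show "T x = 0" if "k \<in> A" "x \<in> PiE {1..d} Z" "x k \<in> Y k" for k x
        using insert.prems(3)[OF insertI2[OF that(1)] that(2,3)] .
      show "u k j a = (\<Sum>m\<in>M k. c k j m * w k m a) +
          (\<Sum>l\<in>K k. (\<Sum>y\<in>Y k. \<phi> k l y * u k j y) * g k l a)" if "k \<in> A" "j \<in> J k" for k j a
        using insert.prems(4)[OF insertI2[OF that(1)] that(2)] .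
    qed
    have "sliced_by d Z (?J(i := M i)) (?u(i := w i)) T"
    proof (rule sliced_by_kernel[OF *])
      show "i \<in> {1..d}" using insert.prems(1) by simp
      show "Y i \<subseteq> Z i" by (rule insert.prems(2)) simp
      show "T x = 0" if "x \<in> PiE {1..d} Z" "x i \<in> Y i" for x
        using that by (rule insert.prems(3)[OF insertI1])
      show "?u i j a = (\<Sum>k\<in>M i. c i j k * w i k a) +
          (\<Sum>l\<in>K i. (\<Sum>y\<in>Y i. \<phi> i l y * ?u i j y) * g i l a)" if "j \<in> ?J i" for j a
      proof -
        have "j \<in> J i" using that insert.hyps(2) by simp
        from insert.prems(4)[OF insertI1 this, of a] insert.hyps(2) show ?thesis
          by (simp only: if_False)
      qed
    qed
    moreover have "?J(i := M i) = (\<lambda>k. if k \<in> insert i A then M k else J k)"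
      "?u(i := w i) = (\<lambda>k. if k \<in> insert i A then w k else u k)"
      by (simp_all add: fun_eq_iff)
    ultimately show ?case by simp
  qed
qed

section \<open>Lower bound: superadditivity on direct sums\<close>

lemma slice_rank_direct_sum_ge:
  fixes X X1 X2 :: "nat \<Rightarrow> 'a set" and T1 T2 :: "('a, 'f::field) tensor"
  assumes d: "d \<ge> 2"
    and fin: "\<And>i. i \<in> {1..d} \<Longrightarrow> finite (X i)"
    and un: "\<And>i. i \<in> {1..d} \<Longrightarrow> X i = X1 i \<union> X2 i"
    and disj: "\<And>i. i \<in> {1..d} \<Longrightarrow> X1 i \<inter> X2 i = {}"
  shows "slice_rank d X1 T1 + slice_rank d X2 T2 \<le>
    slice_rank d X (tensor_direct_sum d X1 X2 T1 T2)"
proof -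
  let ?T = "tensor_direct_sum d X1 X2 T1 T2"
  have one: "1 \<in> {1..d}" and two: "2 \<in> {1..d}" using d by auto
  obtain J :: "nat \<Rightarrow> nat set" and u where dec: "sliced_by d X J u ?T"
    and finJ: "\<And>i. finite (J i)" and card: "(\<Sum>i\<in>{1..d}. card (J i)) = slice_rank d X ?T"
    by (rule sliced_by_slice_rank[of d X ?T]) (use d fin in auto)
  define Y where "Y i = (if i = 1 then X1 i else X2 i)" for i
  have YX: "Y i \<subseteq> X i" if "i \<in> {1..d}" for i using un[OF that] by (auto simp: Y_def)
  have "\<forall>i. \<exists>K w g \<phi> c. i \<in> {1..d} \<longrightarrow> K \<subseteq> J i \<and> (\<forall>k\<in>J i - K. \<forall>y\<in>Y i. w k y = 0) \<and>
    (\<forall>j\<in>J i. \<forall>a. u i j a = (\<Sum>k\<in>J i - K. c j k * w k a) +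
      (\<Sum>l\<in>K. (\<Sum>y\<in>Y i. \<phi> l y * u i j y) * g l a))"
  proof
    fix i
    show "\<exists>K w g \<phi> c. i \<in> {1..d} \<longrightarrow> K \<subseteq> J i \<and> (\<forall>k\<in>J i - K. \<forall>y\<in>Y i. w k y = 0) \<and>
      (\<forall>j\<in>J i. \<forall>a. u i j a = (\<Sum>k\<in>J i - K. c j k * w k a) +
        (\<Sum>l\<in>K. (\<Sum>y\<in>Y i. \<phi> l y * u i j y) * g l a))"
    proof (cases "i \<in> {1..d}")
      case True
      then have "finite (Y i)" using YX fin finite_subset by blast
      from restriction_kernel_split[OF finJ[of i] this, of "u i"] True show ?thesis by simp
    qed auto
  qed
  from this[THEN choice] obtain K where
    "\<forall>i. \<exists>w g \<phi> c. i \<in> {1..d} \<longrightarrow> K i \<subseteq> J i \<and> (\<forall>k\<in>J i - K i. \<forall>y\<in>Y i. w k y = 0) \<and>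
      (\<forall>j\<in>J i. \<forall>a. u i j a = (\<Sum>k\<in>J i - K i. c j k * w k a) +
        (\<Sum>l\<in>K i. (\<Sum>y\<in>Y i. \<phi> l y * u i j y) * g l a))" ..
  from this[THEN choice] obtain w where
    "\<forall>i. \<exists>g \<phi> c. i \<in> {1..d} \<longrightarrow> K i \<subseteq> J i \<and> (\<forall>k\<in>J i - K i. \<forall>y\<in>Y i. w i k y = 0) \<and>
      (\<forall>j\<in>J i. \<forall>a. u i j a = (\<Sum>k\<in>J i - K i. c j k * w i k a) +
        (\<Sum>l\<in>K i. (\<Sum>y\<in>Y i. \<phi> l y * u i j y) * g l a))" ..
  from this[THEN choice] obtain g where
    "\<forall>i. \<exists>\<phi> c. i \<in> {1..d} \<longrightarrow> K i \<subseteq> J i \<and> (\<forall>k\<in>J i - K i. \<forall>y\<in>Y i. w i k y = 0) \<and>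
      (\<forall>j\<in>J i. \<forall>a. u i j a = (\<Sum>k\<in>J i - K i. c j k * w i k a) +
        (\<Sum>l\<in>K i. (\<Sum>y\<in>Y i. \<phi> l y * u i j y) * g i l a))" ..
  from this[THEN choice] obtain \<phi> where
    "\<forall>i. \<exists>c. i \<in> {1..d} \<longrightarrow> K i \<subseteq> J i \<and> (\<forall>k\<in>J i - K i. \<forall>y\<in>Y i. w i k y = 0) \<and>
      (\<forall>j\<in>J i. \<forall>a. u i j a = (\<Sum>k\<in>J i - K i. c j k * w i k a) +
        (\<Sum>l\<in>K i. (\<Sum>y\<in>Y i. \<phi> i l y * u i j y) * g i l a))" ..
  from this[THEN choice] obtain c where
    all: "\<forall>i. i \<in> {1..d} \<longrightarrow> K i \<subseteq> J i \<and> (\<forall>k\<in>J i - K i. \<forall>y\<in>Y i. w i k y = 0) \<and>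
      (\<forall>j\<in>J i. \<forall>a. u i j a = (\<Sum>k\<in>J i - K i. c i j k * w i k a) +
        (\<Sum>l\<in>K i. (\<Sum>y\<in>Y i. \<phi> i l y * u i j y) * g i l a))" ..
  have K: "K i \<subseteq> J i" if "i \<in> {1..d}" for i
    using all that by blast
  have w: "w i k y = 0" if "i \<in> {1..d}" "k \<in> J i - K i" "y \<in> Y i" for i k y
    using all that by blast
  have split: "u i j a = (\<Sum>k\<in>J i - K i. c i j k * w i k a) +
      (\<Sum>l\<in>K i. (\<Sum>y\<in>Y i. \<phi> i l y * u i j y) * g i l a)" if "i \<in> {1..d}" "j \<in> J i" for i j a
    using all that by blast
  \<comment> \<open>The kernel functions vanish on \<open>Y i\<close>, so the restricted factors lie
    in the span of the \<open>g i l\<close>.\<close>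
  have on_Y: "\<exists>b. \<forall>a\<in>Y i. u i j a = (\<Sum>l\<in>K i. b l * g i l a)"
    if i: "i \<in> {1..d}" and j: "j \<in> J i" for i j
  proof (intro exI ballI)
    fix a assume "a \<in> Y i"
    then have "(\<Sum>k\<in>J i - K i. c i j k * w i k a) = 0"
      using w[OF i] by (intro sum.neutral) auto
    then show "u i j a = (\<Sum>l\<in>K i. (\<lambda>l. \<Sum>y\<in>Y i. \<phi> i l y * u i j y) l * g i l a)"
      using split[OF i j, of a] by simp
  qed
  \<comment> \<open>The trivial expansion, for directions in which the factors are already the
    kernel functions.\<close>
  have same: "\<exists>b. \<forall>a\<in>A. f k a = (\<Sum>l\<in>M. b l * f l a)"
    if "finite M" "k \<in> M" for A :: "'a set" and f :: "nat \<Rightarrow> 'a \<Rightarrow> 'f" and M k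
  proof (intro exI ballI)
    fix a
    have "(\<Sum>l\<in>M. (if l = k then 1 else 0) * f l a) = (\<Sum>l\<in>M. if l = k then f l a else 0)"
      by (intro sum.cong) auto
    then show "f k a = (\<Sum>l\<in>M. (\<lambda>l. if l = k then 1 else 0) l * f l a)"
      using that by simp
  qed

  \<comment> \<open>\<open>K i\<close> indexes the restrictions to \<open>Y i\<close> and
    \<open>J i - K i\<close> the kernel. In each direction \<open>T1\<close> and \<open>T2\<close>
    receive complementary parts of \<open>J i\<close>, so the counts add up.\<close>
  define J1 where "J1 i = (if i = 1 then K i else J i - K i)" for i
  define J2 where "J2 i = (if i = 1 then J i - K i else K i)" for i
  have finK: "finite (K i)" if "i \<in> {1..d}" for i
    using K[OF that] finJ by (rule finite_subset)

  have "slice_rank d X1 T1 \<le> (\<Sum>i\<in>{1..d}. card (J1 i))"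
  proof (rule slice_rank_le_sliced_by)
    \<comment> \<open>Only direction 1 is cut down at first. The others keep all of
      \<open>X i\<close>, since passing to kernels evaluates the tensor at points with
      \<open>x i\<close> in \<open>X2 i\<close>.\<close>
    let ?Z = "X(1 := X1 1)" and ?A = "{1..d} - {1}"
    have "sliced_by d ?Z J u ?T"
      by (rule sliced_by_mono[OF dec]) (use un[OF one] in auto)
    then have "sliced_by d ?Z (\<lambda>i. if i \<in> ?A then J i - K i else J i)
        (\<lambda>i. if i \<in> ?A then w i else u i) ?T"
    proof (rule sliced_by_kernels)
      show "?A \<subseteq> {1..d}" by auto
      show "Y i \<subseteq> ?Z i" if "i \<in> ?A" for i using YX[of i] that by auto
      show "?T x = 0" if i: "i \<in> ?A" and x: "x \<in> PiE {1..d} ?Z" "x i \<in> Y i" for i x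
      proof -
        have "x 1 \<in> X1 1" using PiE_mem[OF x(1) one] by simp
        then have "x 1 \<notin> X2 1" using disj[OF one] by blast
        moreover have "x i \<notin> X1 i" using x(2) i disj[of i] by (auto simp: Y_def)
        ultimately show ?thesis
          using one i unfolding tensor_direct_sum_def by (metis DiffD1)
      qed
      show "u i j a = (\<Sum>k\<in>J i - K i. c i j k * w i k a) +
          (\<Sum>l\<in>K i. (\<Sum>y\<in>Y i. \<phi> i l y * u i j y) * g i l a)" if "i \<in> ?A" "j \<in> J i" for i j a
        using that by (intro split) auto
    qed
    \<comment> \<open>With the kernels in place the box shrinks to \<open>X1\<close>, where the
      direct sum is \<open>T1\<close>. In direction 1 this leaves \<open>Y 1\<close>, so
      \<open>on_Y\<close> will apply.\<close>
    then have "sliced_by d X1 (\<lambda>i. if i \<in> ?A then J i - K i else J i)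
        (\<lambda>i. if i \<in> ?A then w i else u i) T1"
      by (rule sliced_by_mono) (use un in \<open>auto simp: tensor_direct_sum_def PiE_mem\<close>)
    then show "sliced_by d X1 J1 (\<lambda>i. if i = 1 then g i else w i) T1"
    proof (rule sliced_by_change_span)
      fix i j assume i: "i \<in> {1..d}" and j: "j \<in> (if i \<in> ?A then J i - K i else J i)"
      show "\<exists>b. \<forall>a\<in>X1 i. (if i \<in> ?A then w i else u i) j a =
          (\<Sum>k\<in>J1 i. b k * (if i = 1 then g i else w i) k a)"
        using on_Y[OF i] same[of "J i - K i" j "X1 i" "w i"] i j finJ[of i]
        by (cases "i = 1") (auto simp: J1_def Y_def)
    qed
    show "finite (J1 i)" if "i \<in> {1..d}" for i using finJ finK that by (simp add: J1_def)
  qed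
  moreover have "slice_rank d X2 T2 \<le> (\<Sum>i\<in>{1..d}. card (J2 i))"
  proof (rule slice_rank_le_sliced_by)
    \<comment> \<open>Confining direction 2 to \<open>X2 2\<close> makes the direct sum vanish for
      \<open>x 1\<close> in \<open>X1 1\<close>, which is \<open>Y 1\<close>; here
      \<open>d >= 2\<close> provides the second direction. Direction 1 keeps all of
      \<open>X 1\<close>.\<close>
    let ?Z = "X(2 := X2 2)" and ?A = "{1 :: nat}"
    have "sliced_by d ?Z J u ?T"
      by (rule sliced_by_mono[OF dec]) (use un[OF two] in auto)
    then have "sliced_by d ?Z (\<lambda>i. if i \<in> ?A then J i - K i else J i)
        (\<lambda>i. if i \<in> ?A then w i else u i) ?T"
    proof (rule sliced_by_kernels)
      show "?A \<subseteq> {1..d}" using one by simp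
      show "Y i \<subseteq> ?Z i" if "i \<in> ?A" for i using YX[OF one] that by auto
      show "?T x = 0" if i: "i \<in> ?A" and x: "x \<in> PiE {1..d} ?Z" "x i \<in> Y i" for i x
      proof -
        have "x 2 \<in> X2 2" using PiE_mem[OF x(1) two] by simp
        then have "x 2 \<notin> X1 2" using disj[OF two] by blast
        moreover have "x 1 \<notin> X2 1" using x(2) i disj[OF one] by (auto simp: Y_def)
        ultimately show ?thesis
          using one two unfolding tensor_direct_sum_def by metis
      qed
      show "u i j a = (\<Sum>k\<in>J i - K i. c i j k * w i k a) +
          (\<Sum>l\<in>K i. (\<Sum>y\<in>Y i. \<phi> i l y * u i j y) * g i l a)" if "i \<in> ?A" "j \<in> J i" for i j a
        using that one by (intro split) auto
    qed
    then have "sliced_by d X2 (\<lambda>i. if i \<in> ?A then J i - K i else J i)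
        (\<lambda>i. if i \<in> ?A then w i else u i) T2"
    proof (rule sliced_by_mono)
      show "X2 i \<subseteq> ?Z i" if "i \<in> {1..d}" for i using un[OF that] by auto
      show "T2 x = ?T x" if x: "x \<in> PiE {1..d} X2" for x
      proof -
        \<comment> \<open>The direct sum tests the box \<open>X1\<close> first, so \<open>x\<close>
          has to be excluded from it; one coordinate suffices.\<close>
        have "x 1 \<notin> X1 1" using PiE_mem[OF x one] disj[OF one] by blast
        then show ?thesis using one x by (auto simp: tensor_direct_sum_def PiE_mem)
      qed
    qed
    then show "sliced_by d X2 J2 (\<lambda>i. if i = 1 then w i else g i) T2"
    proof (rule sliced_by_change_span)
      fix i j assume i: "i \<in> {1..d}" and j: "j \<in> (if i \<in> ?A then J i - K i else J i)"
      show "\<exists>b. \<forall>a\<in>X2 i. (if i \<in> ?A then w i else u i) j a =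
          (\<Sum>k\<in>J2 i. b k * (if i = 1 then w i else g i) k a)"
        using on_Y[OF i] same[of "J i - K i" j "X2 i" "w i"] i j finJ[of i]
        by (cases "i = 1") (auto simp: J2_def Y_def)
    qed
    show "finite (J2 i)" if "i \<in> {1..d}" for i using finJ finK that by (simp add: J2_def)
  qed
  moreover have "(\<Sum>i\<in>{1..d}. card (J1 i)) + (\<Sum>i\<in>{1..d}. card (J2 i)) = (\<Sum>i\<in>{1..d}. card (J i))"
    unfolding sum.distrib[symmetric]
  proof (intro sum.cong refl)
    fix i assume i: "i \<in> {1..d}"
    show "card (J1 i) + card (J2 i) = card (J i)"
      using card_Diff_subset[OF finK[OF i] K[OF i]] card_mono[OF finJ K[OF i]]
      by (cases "i = 1") (simp_all add: J1_def J2_def)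
  qed
  ultimately show ?thesis using card by linarith
qed

section \<open>Upper bound: subadditivity on direct sums\<close>

text \<open>The indicator of a box is a product over the coordinates: its part at \<open>i\<close>
  is absorbed into \<open>u\<close> and the rest into \<open>v\<close>, so extension by zero gives a
  slice in the same direction.\<close>

lemma slice_rank_one_extend:
  fixes S :: "('a, 'f::field) tensor"
  assumes "slice_rank_one d X' S"
  shows "slice_rank_one d X (\<lambda>x. if \<forall>i\<in>{1..d}. x i \<in> X' i then S x else 0)"
proof -
  obtain i u v where i: "i \<in> {1..d}"
    and S: "\<And>x. x \<in> PiE {1..d} X' \<Longrightarrow> S x = u (x i) * v (restrict x ({1..d} - {i}))"
    using assms unfolding slice_rank_one_def by (elim bexE exE) (erule that, erule bspec)
  show ?thesis
    unfolding slice_rank_one_def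
  proof (intro bexI[OF _ i] exI ballI)
    fix x assume x: "x \<in> PiE {1..d} X"
    have "x \<in> PiE {1..d} X'" if "\<forall>i\<in>{1..d}. x i \<in> X' i"
      using that by (intro PiE_I) (auto simp: PiE_arb[OF x])
    then have "(if \<forall>i\<in>{1..d}. x i \<in> X' i then S x else 0) =
        (if \<forall>i\<in>{1..d}. x i \<in> X' i then u (x i) * v (restrict x ({1..d} - {i})) else 0)"
      using S by presburger
    moreover have "(\<forall>k\<in>{1..d}. x k \<in> X' k) \<longleftrightarrow>
        x i \<in> X' i \<and> (\<forall>k\<in>{1..d} - {i}. restrict x ({1..d} - {i}) k \<in> X' k)"
      using i by auto
    ultimately show "(if \<forall>i\<in>{1..d}. x i \<in> X' i then S x else 0) =
        (\<lambda>a. if a \<in> X' i then u a else 0) (x i) *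
        (\<lambda>z. if \<forall>k\<in>{1..d} - {i}. z k \<in> X' k then v z else 0) (restrict x ({1..d} - {i}))"
      by simp
  qed
qed

text \<open>Decompositions of the two summands, extended by zero outside their boxes, are put side
  by side over a disjoint sum of index sets.\<close>

lemma slice_rank_direct_sum_le:
  fixes X X1 X2 :: "nat \<Rightarrow> 'a set" and T1 T2 :: "('a, 'f::field) tensor"
  assumes d: "d \<ge> 1"
    and fin: "\<And>i. i \<in> {1..d} \<Longrightarrow> finite (X i)"
    and un: "\<And>i. i \<in> {1..d} \<Longrightarrow> X i = X1 i \<union> X2 i"
    and disj: "\<And>i. i \<in> {1..d} \<Longrightarrow> X1 i \<inter> X2 i = {}"
  shows "slice_rank d X (tensor_direct_sum d X1 X2 T1 T2) \<le>
    slice_rank d X1 T1 + slice_rank d X2 T2"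
proof -
  let ?r1 = "slice_rank d X1 T1" and ?r2 = "slice_rank d X2 T2"
  have one: "1 \<in> {1..d}" using d by simp
  obtain S1 :: "nat \<Rightarrow> ('a, 'f) tensor"
    where S1: "\<And>j. j < ?r1 \<Longrightarrow> slice_rank_one d X1 (S1 j)"
      and T1: "\<And>x. x \<in> PiE {1..d} X1 \<Longrightarrow> T1 x = (\<Sum>j<?r1. S1 j x)"
    by (rule slice_rank_decomposition[OF d, of X1 T1]) (use fin un in auto)
  obtain S2 :: "nat \<Rightarrow> ('a, 'f) tensor"
    where S2: "\<And>j. j < ?r2 \<Longrightarrow> slice_rank_one d X2 (S2 j)"
      and T2: "\<And>x. x \<in> PiE {1..d} X2 \<Longrightarrow> T2 x = (\<Sum>j<?r2. S2 j x)"
    by (rule slice_rank_decomposition[OF d, of X2 T2]) (use fin un in auto)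
  define S where "S = case_sum (\<lambda>j x. if \<forall>i\<in>{1..d}. x i \<in> X1 i then S1 j x else 0)
    (\<lambda>j x. if \<forall>i\<in>{1..d}. x i \<in> X2 i then S2 j x else 0)"
  have "slice_rank d X (tensor_direct_sum d X1 X2 T1 T2) \<le> card ({..<?r1} <+> {..<?r2})"
  proof (rule slice_rank_le_card)
    show "finite ({..<?r1} <+> {..<?r2})" by simp
    show "slice_rank_one d X (S j)" if "j \<in> {..<?r1} <+> {..<?r2}" for j
      using that S1 S2 by (auto simp only: S_def lessThan_iff sum.case intro!: slice_rank_one_extend)
    fix x assume x: "x \<in> PiE {1..d} X"
    have *: "x \<in> PiE {1..d} X'" if "\<forall>i\<in>{1..d}. x i \<in> X' i" for X'
      using that by (intro PiE_I) (auto simp: PiE_arb[OF x])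
    define p1 p2 where "p1 \<longleftrightarrow> (\<forall>i\<in>{1..d}. x i \<in> X1 i)" and "p2 \<longleftrightarrow> (\<forall>i\<in>{1..d}. x i \<in> X2 i)"
    note p_defs = p1_def p2_def
    have "p1 \<Longrightarrow> T1 x = (\<Sum>j<?r1. S1 j x)" "p2 \<Longrightarrow> T2 x = (\<Sum>j<?r2. S2 j x)"
      using T1[OF *] T2[OF *] unfolding p_defs by blast+
    \<comment> \<open>Disjointness in coordinate 1 ensures that at each point at most one of the two
      families contributes, in agreement with the nested conditional.\<close>
    moreover have "\<not> (p1 \<and> p2)"
      using one disj[OF one] unfolding p_defs by blast
    moreover have "tensor_direct_sum d X1 X2 T1 T2 x = (if p1 then T1 x else if p2 then T2 x else 0)"
      by (simp only: tensor_direct_sum_def p_defs)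
    moreover have "S (Inl j) x = (if p1 then S1 j x else 0)" "S (Inr j) x = (if p2 then S2 j x else 0)" for j
      by (simp_all only: S_def p_defs sum.case)
    ultimately show "tensor_direct_sum d X1 X2 T1 T2 x = (\<Sum>j\<in>{..<?r1} <+> {..<?r2}. S j x)"
      by (auto simp: sum.Plus)
  qed
  then show ?thesis by (simp add: card_Plus)
qed

theorem theorem2:
  fixes d :: nat
    and X X1 X2 :: "nat \<Rightarrow> 'a set"
    and T1 T2 :: "('a, 'f::field) tensor"
  assumes "d \<ge> 2"
    and "\<And>i. i \<in> {1..d} \<Longrightarrow> finite (X i)"
    and "\<And>i. i \<in> {1..d} \<Longrightarrow> X i = X1 i \<union> X2 i"
    and "\<And>i. i \<in> {1..d} \<Longrightarrow> X1 i \<inter> X2 i = {}"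
  shows "slice_rank d X (tensor_direct_sum d X1 X2 T1 T2) =
           slice_rank d X1 T1 + slice_rank d X2 T2"
proof (rule antisym)
  show "slice_rank d X (tensor_direct_sum d X1 X2 T1 T2) \<le>
      slice_rank d X1 T1 + slice_rank d X2 T2"
    by (rule slice_rank_direct_sum_le) (use assms in auto)
  show "slice_rank d X1 T1 + slice_rank d X2 T2 \<le>
      slice_rank d X (tensor_direct_sum d X1 X2 T1 T2)"
    by (rule slice_rank_direct_sum_ge) (use assms in auto)
qed

end
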